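(* For all $k\ge 1$, $$I_{12\dots k}(x)=\frac{1}{x\,U_k\left(\frac{1}{2x}\right)}\sum_{j=0}^{k-1}U_j\left(\frac{1}{2x}\right),$$ where $I_{12\dots k}(x)=\sum_{n\ge 0}I_{12\dots k}(n)x^n$ and $I_{12\dots k}(n)$ is the number of involutions in $S_n$ avoiding both $132$ and $12\dots k$.
   Context: $S_n$ is the set of permutations of $\{1,\dots,n\}$. A permutation $\alpha\in S_n$ contains a pattern $\tau\in S_k$ if there are $1\le i_1<\dots<i_k\le n$ such that $(\alpha_{i_1},\dots,\alpha_{i_k})$ is order-isomorphic to $\tau$; otherwise $\alpha$ avoids $\tau$. An involution is a permutation equal to its own inverse; the empty permutation is counted for $n=0$. $U_r$ denotes the Chebyshev polynomial of the second kind, $U_r(\cos\theta)=\sin((r+1)\theta)/\sin\theta$. The identity is one of rational functions, expanded as power series in $x$. *)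

theory Defs
  imports
    Complex_Main
    "HOL-Combinatorics.Permutations"
    "HOL-Computational_Algebra.Formal_Laurent_Series"
    "HOL-Computational_Algebra.Polynomial"
begin

text \<open>
  Permutations of \<open>{1..n}\<close> are functions \<open>\<alpha> :: nat \<Rightarrow> nat\<close> with \<open>\<alpha> permutes {1..n}\<close>; the
  one-line notation of \<open>\<alpha>\<close> is \<open>\<alpha> 1, \<dots>, \<alpha> n\<close>.  The lengths \<open>n\<close> and \<open>k\<close> are explicit arguments,
  because they cannot be recovered from the functions.
\<close>

definition contains_pattern :: "nat \<Rightarrow> (nat \<Rightarrow> nat) \<Rightarrow> nat \<Rightarrow> (nat \<Rightarrow> nat) \<Rightarrow> bool" where
  "contains_pattern n \<alpha> k \<tau> \<longleftrightarrow>
     (\<exists>i. strict_mono_on {1..k} i \<and> i ` {1..k} \<subseteq> {1..n} \<and>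
          (\<forall>a\<in>{1..k}. \<forall>b\<in>{1..k}. \<alpha> (i a) < \<alpha> (i b) \<longleftrightarrow> \<tau> a < \<tau> b))"

abbreviation avoids_pattern :: "nat \<Rightarrow> (nat \<Rightarrow> nat) \<Rightarrow> nat \<Rightarrow> (nat \<Rightarrow> nat) \<Rightarrow> bool" where
  "avoids_pattern n \<alpha> k \<tau> \<equiv> \<not> contains_pattern n \<alpha> k \<tau>"

definition pattern_132 :: "nat \<Rightarrow> nat" where
  "pattern_132 = transpose 2 3"

text \<open>The pattern \<open>12\<dots>k\<close> is \<open>id\<close>, taken with length \<open>k\<close>.\<close>

definition num_involutions :: "nat \<Rightarrow> nat \<Rightarrow> nat" where
  "num_involutions k n =
     card {\<alpha>. \<alpha> permutes {1..n} \<and> inv \<alpha> = \<alpha> \<and>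
              avoids_pattern n \<alpha> 3 pattern_132 \<and> avoids_pattern n \<alpha> k id}"

definition involution_gf :: "nat \<Rightarrow> real fps" where
  "involution_gf k = Abs_fps (\<lambda>n. real (num_involutions k n))"

definition chebyshev_U :: "nat \<Rightarrow> real poly" where
  "chebyshev_U r =
     (THE p. \<forall>\<theta>. sin \<theta> \<noteq> 0 \<longrightarrow> poly p (cos \<theta>) = sin (real (r + 1) * \<theta>) / sin \<theta>)"

lemma ex1_chebyshev_U:
  "\<exists>!p :: real poly. \<forall>\<theta>. sin \<theta> \<noteq> 0 \<longrightarrow> poly p (cos \<theta>) = sin (real (r + 1) * \<theta>) / sin \<theta>"
proof (rule ex_ex1I)
  show "\<exists>p :: real poly. \<forall>\<theta>. sin \<theta> \<noteq> 0 \<longrightarrow> poly p (cos \<theta>) = sin (real (r + 1) * \<theta>) / sin \<theta>"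
  proof (induction r rule: nat_less_induct)
    case (1 r)
    consider "r = 0" | "r = 1" | s where "r = Suc (Suc s)"
      by (metis One_nat_def not0_implies_Suc)
    then show ?case
    proof cases
      case 1
      then show ?thesis by (intro exI[of _ 1]) simp
    next
      case 2
      then show ?thesis
        by (intro exI[of _ "[:0, 2:]"]) (simp add: sin_double)
    next
      case 3
      from 1 3 obtain p q :: "real poly"
        where p: "\<And>\<theta>. sin \<theta> \<noteq> 0 \<Longrightarrow> poly p (cos \<theta>) = sin (real (s + 1) * \<theta>) / sin \<theta>"
          and q: "\<And>\<theta>. sin \<theta> \<noteq> 0 \<Longrightarrow> poly q (cos \<theta>) = sin (real (Suc s + 1) * \<theta>) / sin \<theta>"
        by (meson lessI less_SucI)
      have rec: "sin (real (r + 1) * \<theta>) =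
          2 * cos \<theta> * sin (real (Suc s + 1) * \<theta>) - sin (real (s + 1) * \<theta>)" for \<theta>
      proof -
        have "real (r + 1) * \<theta> = real (Suc s + 1) * \<theta> + \<theta>"
             "real (s + 1) * \<theta> = real (Suc s + 1) * \<theta> - \<theta>"
          using 3 by (simp_all add: algebra_simps)
        then show ?thesis by (simp only: sin_add sin_diff) (simp add: algebra_simps)
      qed
      show ?thesis
        unfolding rec
        by (intro exI[of _ "[:0, 2:] * q - p"]) (simp add: p q diff_divide_distrib)
    qed
  qed
next
  fix p q :: "real poly"
  assume p: "\<forall>\<theta>. sin \<theta> \<noteq> 0 \<longrightarrow> poly p (cos \<theta>) = sin (real (r + 1) * \<theta>) / sin \<theta>"
    and q: "\<forall>\<theta>. sin \<theta> \<noteq> 0 \<longrightarrow> poly q (cos \<theta>) = sin (real (r + 1) * \<theta>) / sin \<theta>"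
  have "poly (p - q) x = 0" if "x \<in> {-1<..<1}" for x
  proof -
    have "sin (arccos x) \<noteq> 0"
      using that by (intro sin_arccos_nonzero) auto
    then have "poly p (cos (arccos x)) = poly q (cos (arccos x))"
      using p q by metis
    then show ?thesis using that by (simp add: cos_arccos)
  qed
  then have "{-1<..<1} \<subseteq> {x. poly (p - q) x = 0}" by auto
  then have "infinite {x. poly (p - q) x = 0}"
    by (rule infinite_super) (rule infinite_Ioo, simp)
  then show "p = q"
    using poly_roots_finite[of "p - q"] right_minus_eq by blast
qed

lemma poly_chebyshev_U:
  assumes "sin \<theta> \<noteq> 0"
  shows "poly (chebyshev_U r) (cos \<theta>) = sin (real (r + 1) * \<theta>) / sin \<theta>"
  using theI'[OF ex1_chebyshev_U[of r]] assms unfolding chebyshev_U_def by blast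

text \<open>
  Rational functions in \<open>x\<close> are read in the field of formal Laurent series, which contains both
  \<open>\<real>(x)\<close> and the power series: \<open>chebyshev_U_at r t\<close> is \<open>U\<^sub>r(t)\<close> for a Laurent series \<open>t\<close>.
\<close>

definition chebyshev_U_at :: "nat \<Rightarrow> real fls \<Rightarrow> real fls" where
  "chebyshev_U_at r t = poly (map_poly fls_const (chebyshev_U r)) t"

end

theory Submission
  imports Defs
begin

text \<open>
  The entries before the maximum of a 132-avoiding permutation exceed those after it, so the
  permutation is a skew sum of \<open>\<beta> \<oplus> 1\<close> and \<open>\<gamma>\<close> with \<open>\<beta>\<close> and \<open>\<gamma>\<close> avoiding 132.  An increasing
  subsequence of a skew sum lies in one summand, and \<open>\<oplus> 1\<close> lengthens the longest one by 1.  For the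
  generating functions \<open>C\<^sub>k\<close> of the permutations avoiding 132 and \<open>12\<dots>k\<close> this gives
  \<open>C\<^sub>k\<^sub>+\<^sub>1 = 1 + x C\<^sub>k C\<^sub>k\<^sub>+\<^sub>1\<close>.

  Inversion reverses the order of the summands.  Hence an involution avoiding 132 is either
  \<open>\<beta> \<oplus> 1\<close> with \<open>\<beta>\<close> an involution, or the skew sum of \<open>\<beta> \<oplus> 1\<close>, an involution \<open>\<tau>\<close> and
  \<open>\<beta>\<^sup>-\<^sup>1 \<oplus> 1\<close>, with \<open>\<beta>\<close> arbitrary.  This gives
  \<open>I\<^sub>k\<^sub>+\<^sub>1(x) = 1 + x I\<^sub>k(x) + x\<^sup>2 C\<^sub>k(x\<^sup>2) I\<^sub>k\<^sub>+\<^sub>1(x)\<close>.  Writing \<open>U\<^sub>k\<close> for \<open>U\<^sub>k(1/2x)\<close>, the recurrence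
  \<open>x U\<^sub>k\<^sub>+\<^sub>1 = U\<^sub>k - x U\<^sub>k\<^sub>-\<^sub>1\<close> yields \<open>x C\<^sub>k(x\<^sup>2) = U\<^sub>k\<^sub>-\<^sub>1 / U\<^sub>k\<close>, and then
  \<open>x U\<^sub>k\<^sub>+\<^sub>1 I\<^sub>k\<^sub>+\<^sub>1 = U\<^sub>k + x U\<^sub>k I\<^sub>k\<close>.
\<close>

section \<open>Skew sums\<close>

text \<open>The lengths are arguments because the functions do not determine them. Being the
  identity beyond \<open>a + b\<close> is what \<open>permutes\<close> demands.\<close>

definition skew_sum :: "nat \<Rightarrow> nat \<Rightarrow> (nat \<Rightarrow> nat) \<Rightarrow> (nat \<Rightarrow> nat) \<Rightarrow> nat \<Rightarrow> nat" where
  "skew_sum a b \<beta> \<gamma> i =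
     (if i \<in> {1..a} then \<beta> i + b else if i \<in> {a + 1..a + b} then \<gamma> (i - a) else i)"

lemma permutes_atLeastAtMost_bounds:
  fixes \<beta> :: "nat \<Rightarrow> nat"
  assumes "\<beta> permutes {1..a}" "1 \<le> i" "i \<le> a"
  shows "1 \<le> \<beta> i" "\<beta> i \<le> a"
  using permutes_in_image[OF assms(1), of i] assms(2,3) by auto

text \<open>A pointwise left inverse, checked block by block. It yields injectivity first and, once
  bijectivity is known, the formula for the inverse.\<close>

lemma skew_sum_inverse:
  assumes "\<beta> permutes {1..a}" "\<gamma> permutes {1..b}"
  shows "skew_sum b a (inv \<gamma>) (inv \<beta>) (skew_sum a b \<beta> \<gamma> i) = i"
proof -
  consider "i \<in> {1..a}" | "i \<in> {a+1..a+b}" | "i \<notin> {1..a+b}" by fastforce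
  then show ?thesis
  proof cases
    case 1
    then have "1 \<le> \<beta> i" "\<beta> i \<le> a"
      using permutes_atLeastAtMost_bounds[OF assms(1)] by auto
    then show ?thesis using 1 by (simp add: skew_sum_def permutes_inverses[OF assms(1)])
  next
    case 2
    then have "1 \<le> \<gamma> (i - a)" "\<gamma> (i - a) \<le> b"
      using permutes_atLeastAtMost_bounds[OF assms(2), of "i - a"] by auto
    then show ?thesis using 2 by (simp add: skew_sum_def permutes_inverses[OF assms(2)])
  next
    case 3
    then show ?thesis by (auto simp: skew_sum_def)
  qed
qed

lemma skew_sum_permutes:
  assumes "\<beta> permutes {1..a}" "\<gamma> permutes {1..b}"
  shows "skew_sum a b \<beta> \<gamma> permutes {1..a + b}"
proof -
  have "inj (skew_sum a b \<beta> \<gamma>)"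
    by (metis skew_sum_inverse[OF assms] injI)
  moreover have "skew_sum a b \<beta> \<gamma> ` {1..a + b} \<subseteq> {1..a + b}"
  proof
    fix y assume "y \<in> skew_sum a b \<beta> \<gamma> ` {1..a + b}"
    then obtain i where i: "i \<in> {1..a+b}" "y = skew_sum a b \<beta> \<gamma> i" by blast
    show "y \<in> {1..a+b}"
    proof (cases "i \<le> a")
      case True
      then show ?thesis using i permutes_atLeastAtMost_bounds[OF assms(1), of i]
        by (simp add: skew_sum_def)
    next
      case False
      then have "1 \<le> i - a" "i - a \<le> b" using i by auto
      then show ?thesis using False i permutes_atLeastAtMost_bounds[OF assms(2), of "i - a"]
        by (simp add: skew_sum_def trans_le_add2)
    qed
  qed
  ultimately have "bij_betw (skew_sum a b \<beta> \<gamma>) {1..a + b} {1..a + b}"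
    by (metis bij_betw_imageI endo_inj_surj finite_atLeastAtMost inj_on_subset subset_UNIV)
  then show ?thesis
    by (rule bij_imp_permutes) (auto simp: skew_sum_def)
qed

lemma inv_skew_sum:
  assumes "\<beta> permutes {1..a}" "\<gamma> permutes {1..b}"
  shows "inv (skew_sum a b \<beta> \<gamma>) = skew_sum b a (inv \<gamma>) (inv \<beta>)"
proof
  fix y
  have "bij (skew_sum a b \<beta> \<gamma>)"
    using skew_sum_permutes[OF assms] permutes_bij by blast
  then obtain x where "y = skew_sum a b \<beta> \<gamma> x" by (meson bij_pointE)
  then show "inv (skew_sum a b \<beta> \<gamma>) y = skew_sum b a (inv \<gamma>) (inv \<beta>) y"
    using \<open>bij _\<close> skew_sum_inverse[OF assms] by (simp add: bij_is_inj)
qed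

text \<open>Makes the counting maps injective. A skew sum sees its summands only on their intervals;
  off them, both sides are the identity by \<open>permutes\<close>.\<close>

lemma skew_sum_eq_iff:
  assumes "\<beta> permutes {1..a}" "\<gamma> permutes {1..b}" "\<beta>' permutes {1..a}" "\<gamma>' permutes {1..b}"
  shows "skew_sum a b \<beta> \<gamma> = skew_sum a b \<beta>' \<gamma>' \<longleftrightarrow> \<beta> = \<beta>' \<and> \<gamma> = \<gamma>'"
proof
  assume eq: "skew_sum a b \<beta> \<gamma> = skew_sum a b \<beta>' \<gamma>'"
  have "\<beta> i = \<beta>' i" for i
  proof (cases "i \<in> {1..a}")
    case True
    then show ?thesis using fun_cong[OF eq, of i] by (simp add: skew_sum_def)
  next
    case False
    then show ?thesis using assms by (metis permutes_not_in)
  qed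
  moreover have "\<gamma> i = \<gamma>' i" for i
  proof (cases "i \<in> {1..b}")
    case True
    then show ?thesis using fun_cong[OF eq, of "a + i"] by (simp add: skew_sum_def)
  next
    case False
    then show ?thesis using assms by (metis permutes_not_in)
  qed
  ultimately show "\<beta> = \<beta>' \<and> \<gamma> = \<gamma>'" by auto
qed simp

lemma skew_sum_assoc:
  "skew_sum (a + b) c (skew_sum a b \<beta> \<gamma>) \<delta> = skew_sum a (b + c) \<beta> (skew_sum b c \<gamma> \<delta>)"
  by (auto simp: skew_sum_def fun_eq_iff)

text \<open>By bijectivity the remaining positions take exactly the values \<open>{1..b}\<close>, so
  shifting each block back gives permutations of initial segments.\<close>

lemma skew_sum_decomposition:
  assumes \<alpha>: "\<alpha> permutes {1..a + b}" and image: "\<alpha> ` {1..a} = {b + 1..a + b}"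
  obtains \<beta> \<gamma> where "\<beta> permutes {1..a}" "\<gamma> permutes {1..b}" "\<alpha> = skew_sum a b \<beta> \<gamma>"
proof -
  have "\<alpha> ` {a + 1..a + b} = \<alpha> ` ({1..a + b} - {1..a})"
    by (rule arg_cong[where f = "image \<alpha>"]) auto
  also have "\<dots> = {1..a + b} - {b + 1..a + b}"
    using image permutes_image[OF \<alpha>] permutes_inj[OF \<alpha>] by (simp add: image_set_diff)
  also have "\<dots> = {1..b}" by auto
  finally have image': "\<alpha> ` {a + 1..a + b} = {1..b}" .
  define \<beta> where "\<beta> i = (if i \<in> {1..a} then \<alpha> i - b else i)" for i
  define \<gamma> where "\<gamma> i = (if i \<in> {1..b} then \<alpha> (i + a) else i)" for i
  have \<alpha>_low: "\<alpha> i \<in> {b + 1..a + b}" if "i \<in> {1..a}" for i using image that by blast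
  have \<alpha>_high: "\<alpha> i \<in> {1..b}" if "i \<in> {a + 1..a + b}" for i using image' that by blast
  have inj: "\<alpha> i = \<alpha> j \<longleftrightarrow> i = j" for i j using permutes_inj[OF \<alpha>] by (meson injD)
  have "inj_on \<beta> {1..a}"
  proof (rule inj_onI)
    fix i j assume "i \<in> {1..a}" "j \<in> {1..a}" "\<beta> i = \<beta> j"
    then have "\<alpha> i - b = \<alpha> j - b" by (simp add: \<beta>_def)
    \<comment> \<open>Truncated subtraction of \<open>b\<close> is injective here, as no value on
      the first block lies below \<open>b\<close>.\<close>
    moreover have "b \<le> \<alpha> i" "b \<le> \<alpha> j"
      using \<alpha>_low[OF \<open>i \<in> {1..a}\<close>] \<alpha>_low[OF \<open>j \<in> {1..a}\<close>] by auto
    ultimately have "\<alpha> i = \<alpha> j" by (simp add: eq_diff_iff)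
    then show "i = j" by (simp add: inj)
  qed
  moreover have "\<beta> ` {1..a} \<subseteq> {1..a}" using \<alpha>_low by (fastforce simp: \<beta>_def)
  ultimately have "bij_betw \<beta> {1..a} {1..a}"
    by (simp add: bij_betw_def endo_inj_surj)
  then have "\<beta> permutes {1..a}" by (rule bij_imp_permutes) (auto simp: \<beta>_def)
  moreover have "inj_on \<gamma> {1..b}" by (rule inj_onI) (simp add: \<gamma>_def inj)
  moreover have "\<gamma> ` {1..b} \<subseteq> {1..b}" using \<alpha>_high by (fastforce simp: \<gamma>_def)
  ultimately have "bij_betw \<gamma> {1..b} {1..b}"
    by (simp add: bij_betw_def endo_inj_surj)
  then have "\<gamma> permutes {1..b}" by (rule bij_imp_permutes) (auto simp: \<gamma>_def)
  moreover have "\<alpha> = skew_sum a b \<beta> \<gamma>"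
  proof
    fix i
    consider "i \<in> {1..a}" | "i \<in> {a+1..a+b}" | "i \<notin> {1..a+b}" by fastforce
    then show "\<alpha> i = skew_sum a b \<beta> \<gamma> i"
    proof cases
      case 1
      then show ?thesis using \<alpha>_low[of i] by (simp add: skew_sum_def \<beta>_def)
    next
      case 2
      then have "\<not> i \<le> a" "1 \<le> i - a" "i - a \<le> b" "i - a + a = i" by auto
      then show ?thesis using 2 by (simp add: skew_sum_def \<gamma>_def)
    next
      case 3
      then show ?thesis using permutes_not_in[OF \<alpha> 3] by (auto simp: skew_sum_def)
    qed
  qed
  ultimately show ?thesis using that \<open>\<beta> permutes {1..a}\<close> by blast
qed

section \<open>Pattern containment\<close>

text \<open>If the pattern starts with its smallest entry, an occurrence starting in the first block
  cannot enter the second, whose values are all lower. Both 132 and \<open>12\<dots>k\<close> are of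
  this kind.\<close>

lemma contains_skew_sum_iff:
  assumes \<beta>: "\<beta> permutes {1..a}" and \<gamma>: "\<gamma> permutes {1..b}"
    and k: "1 \<le> k" and \<tau>: "\<And>c. c \<in> {2..k} \<Longrightarrow> \<tau> 1 < \<tau> c"
  shows "contains_pattern (a + b) (skew_sum a b \<beta> \<gamma>) k \<tau> \<longleftrightarrow>
    contains_pattern a \<beta> k \<tau> \<or> contains_pattern b \<gamma> k \<tau>"
proof
  assume "contains_pattern (a + b) (skew_sum a b \<beta> \<gamma>) k \<tau>"
  then obtain i where mono: "strict_mono_on {1..k} i" and img: "i ` {1..k} \<subseteq> {1..a + b}"
    and ord: "\<And>c d. c \<in> {1..k} \<Longrightarrow> d \<in> {1..k} \<Longrightarrow>
      skew_sum a b \<beta> \<gamma> (i c) < skew_sum a b \<beta> \<gamma> (i d) \<longleftrightarrow> \<tau> c < \<tau> d"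
    unfolding contains_pattern_def by blast
  have bounds: "1 \<le> i c" "i c \<le> a + b" if "c \<in> {1..k}" for c
    using img that by (auto simp: image_subset_iff)
  show "contains_pattern a \<beta> k \<tau> \<or> contains_pattern b \<gamma> k \<tau>"
  proof (cases "i 1 \<le> a")
    case True
    have le: "i c \<le> a" if c: "c \<in> {1..k}" for c
    proof (rule ccontr)
      assume "\<not> i c \<le> a"
      then have "c \<in> {2..k}" using True c by (cases "c = 1") auto
      then have "skew_sum a b \<beta> \<gamma> (i 1) < skew_sum a b \<beta> \<gamma> (i c)"
        using ord[of 1 c] \<tau> c k by auto
      moreover have "\<gamma> (i c - a) \<le> b"
        using \<open>\<not> i c \<le> a\<close> bounds[OF c]
        by (intro permutes_atLeastAtMost_bounds[OF \<gamma>]) auto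
      ultimately show False
        using True \<open>\<not> i c \<le> a\<close> bounds[of 1] bounds[OF c] k
        by (simp add: skew_sum_def)
    qed
    have "\<beta> (i c) < \<beta> (i d) \<longleftrightarrow> \<tau> c < \<tau> d" if "c \<in> {1..k}" "d \<in> {1..k}" for c d
      using ord[OF that] bounds(1) le that by (auto simp: skew_sum_def)
    moreover have "i ` {1..k} \<subseteq> {1..a}" using le bounds(1) by auto
    ultimately show ?thesis using mono unfolding contains_pattern_def by blast
  next
    case False
    \<comment> \<open>Positions increase, so an occurrence starting beyond \<open>a\<close> stays
      there.\<close>
    have gt: "a < i c" if c: "c \<in> {1..k}" for c
      using False strict_mono_on_leD[OF mono, of 1 c] c k by auto
    have "strict_mono_on {1..k} (\<lambda>c. i c - a)"
      using mono gt by (auto simp: strict_mono_on_def intro!: diff_less_mono less_imp_le)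
    moreover have "(\<lambda>c. i c - a) ` {1..k} \<subseteq> {1..b}"
    proof
      fix y assume "y \<in> (\<lambda>c. i c - a) ` {1..k}"
      then obtain c where "c \<in> {1..k}" "y = i c - a" by blast
      then show "y \<in> {1..b}" using gt[of c] bounds[of c] by auto
    qed
    moreover have "\<gamma> (i c - a) < \<gamma> (i d - a) \<longleftrightarrow> \<tau> c < \<tau> d"
      if "c \<in> {1..k}" "d \<in> {1..k}" for c d
      using ord[OF that] bounds[OF that(1)] bounds[OF that(2)] gt[OF that(1)] gt[OF that(2)]
      by (auto simp: skew_sum_def)
    ultimately show ?thesis unfolding contains_pattern_def by blast
  qed
next
  assume "contains_pattern a \<beta> k \<tau> \<or> contains_pattern b \<gamma> k \<tau>"
  then show "contains_pattern (a + b) (skew_sum a b \<beta> \<gamma>) k \<tau>"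
  proof
    assume "contains_pattern a \<beta> k \<tau>"
    then obtain i where i: "strict_mono_on {1..k} i" "i ` {1..k} \<subseteq> {1..a}"
      "\<And>c d. c \<in> {1..k} \<Longrightarrow> d \<in> {1..k} \<Longrightarrow> \<beta> (i c) < \<beta> (i d) \<longleftrightarrow> \<tau> c < \<tau> d"
      unfolding contains_pattern_def by blast
    have "skew_sum a b \<beta> \<gamma> (i c) = \<beta> (i c) + b" if "c \<in> {1..k}" for c
    proof -
      have "i c \<in> {1..a}" using i(2) that by blast
      then show ?thesis by (simp add: skew_sum_def)
    qed
    moreover have "i ` {1..k} \<subseteq> {1..a + b}" using i(2) by fastforce
    ultimately show ?thesis using i(1,3)
      unfolding contains_pattern_def by (intro exI[of _ i]) simp
  next
    assume "contains_pattern b \<gamma> k \<tau>"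
    then obtain i where i: "strict_mono_on {1..k} i" "i ` {1..k} \<subseteq> {1..b}"
      "\<And>c d. c \<in> {1..k} \<Longrightarrow> d \<in> {1..k} \<Longrightarrow> \<gamma> (i c) < \<gamma> (i d) \<longleftrightarrow> \<tau> c < \<tau> d"
      unfolding contains_pattern_def by blast
    have "skew_sum a b \<beta> \<gamma> (i c + a) = \<gamma> (i c)" if "c \<in> {1..k}" for c
      using i(2) that by (fastforce simp: skew_sum_def)
    moreover have "(\<lambda>c. i c + a) ` {1..k} \<subseteq> {1..a + b}" using i(2) by fastforce
    moreover have "strict_mono_on {1..k} (\<lambda>c. i c + a)" using i(1) by (simp add: strict_mono_on_def)
    ultimately show ?thesis using i(3)
      unfolding contains_pattern_def by (intro exI[of _ "\<lambda>c. i c + a"]) simp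
  qed
qed

lemma contains_132_iff:
  "contains_pattern n \<alpha> 3 pattern_132 \<longleftrightarrow>
    (\<exists>p q r. 1 \<le> p \<and> p < q \<and> q < r \<and> r \<le> n \<and> \<alpha> p < \<alpha> r \<and> \<alpha> r < \<alpha> q)"
proof -
  have set3: "{1..3::nat} = {1, 2, 3}" by auto
  have \<tau>: "pattern_132 1 = 1" "pattern_132 2 = 3" "pattern_132 3 = 2"
    by (simp_all add: pattern_132_def transpose_def)
  show ?thesis
  proof
    assume "contains_pattern n \<alpha> 3 pattern_132"
    then obtain i where "strict_mono_on {1, 2, 3} i" "i ` {1, 2, 3} \<subseteq> {1..n}"
      "\<forall>a\<in>{1, 2, 3}. \<forall>b\<in>{1, 2, 3}. \<alpha> (i a) < \<alpha> (i b) \<longleftrightarrow> pattern_132 a < pattern_132 b"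
      unfolding contains_pattern_def set3 by blast
    then show "\<exists>p q r. 1 \<le> p \<and> p < q \<and> q < r \<and> r \<le> n \<and> \<alpha> p < \<alpha> r \<and> \<alpha> r < \<alpha> q"
      by (intro exI[of _ "i 1"] exI[of _ "i 2"] exI[of _ "i 3"])
        (simp add: \<tau>[simplified] strict_mono_on_def)
  next
    assume "\<exists>p q r. 1 \<le> p \<and> p < q \<and> q < r \<and> r \<le> n \<and> \<alpha> p < \<alpha> r \<and> \<alpha> r < \<alpha> q"
    then obtain p q r where pqr: "1 \<le> p" "p < q" "q < r" "r \<le> n" "\<alpha> p < \<alpha> r" "\<alpha> r < \<alpha> q" by blast
    define i where "i c = (if c = 1 then p else if c = 2 then q else r)" for c :: nat
    have "strict_mono_on {1, 2, 3} i" "i ` {1, 2, 3} \<subseteq> {1..n}"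
      "\<forall>a\<in>{1, 2, 3}. \<forall>b\<in>{1, 2, 3}. \<alpha> (i a) < \<alpha> (i b) \<longleftrightarrow> pattern_132 a < pattern_132 b"
      using pqr by (auto simp: i_def \<tau>[simplified] strict_mono_on_def)
    then show "contains_pattern n \<alpha> 3 pattern_132"
      unfolding contains_pattern_def set3 by blast
  qed
qed

text \<open>The new maximum stands last, where it could only play the final entry of 132; but that
  entry is not the largest.\<close>

lemma contains_132_Suc_iff:
  assumes "\<beta> permutes {1..a}"
  shows "contains_pattern (Suc a) \<beta> 3 pattern_132 \<longleftrightarrow> contains_pattern a \<beta> 3 pattern_132"
proof
  assume "contains_pattern (Suc a) \<beta> 3 pattern_132"
  then obtain p q r where pqr: "1 \<le> p" "p < q" "q < r" "r \<le> Suc a" "\<beta> p < \<beta> r" "\<beta> r < \<beta> q"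
    unfolding contains_132_iff by blast
  have "\<beta> (Suc a) = Suc a" using permutes_not_in[OF assms] by simp
  moreover have "\<beta> q \<le> a" using permutes_atLeastAtMost_bounds[OF assms, of q] pqr by simp
  ultimately have "r \<noteq> Suc a" using pqr(6) by auto
  then have "r \<le> a" using pqr(4) by simp
  then show "contains_pattern a \<beta> 3 pattern_132"
    unfolding contains_132_iff using pqr by blast
next
  assume "contains_pattern a \<beta> 3 pattern_132"
  then show "contains_pattern (Suc a) \<beta> 3 pattern_132"
    unfolding contains_132_iff using le_SucI by blast
qed

text \<open>An increasing sequence in \<open>\<beta> \<oplus> 1\<close> loses its last term to fit
  into \<beta>, and one in \<beta> is extended by the new maximum. This is the source of the
  recursion on \<open>k\<close>.\<close>

lemma contains_id_Suc_iff:
  assumes "\<beta> permutes {1..a}"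
  shows "contains_pattern (Suc a) \<beta> (Suc k) id \<longleftrightarrow> contains_pattern a \<beta> k id"
proof
  assume "contains_pattern (Suc a) \<beta> (Suc k) id"
  then obtain i where i: "strict_mono_on {1..Suc k} i" "i ` {1..Suc k} \<subseteq> {1..Suc a}"
      "\<And>c d. c \<in> {1..Suc k} \<Longrightarrow> d \<in> {1..Suc k} \<Longrightarrow> \<beta> (i c) < \<beta> (i d) \<longleftrightarrow> id c < id d"
    unfolding contains_pattern_def by blast
  have "i c \<in> {1..a}" if "c \<in> {1..k}" for c
  proof -
    have "i c < i (Suc k)" using that by (intro strict_mono_onD[OF i(1)]) auto
    moreover have "i (Suc k) \<le> Suc a" "1 \<le> i c" using i(2) that by (auto simp: image_subset_iff)
    ultimately show ?thesis by simp
  qed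
  moreover have "strict_mono_on {1..k} i"
    using i(1) by (simp add: strict_mono_on_def)
  ultimately show "contains_pattern a \<beta> k id"
    unfolding contains_pattern_def using i(3) by (intro exI[of _ i]) auto
next
  assume "contains_pattern a \<beta> k id"
  then obtain i where i: "strict_mono_on {1..k} i" "i ` {1..k} \<subseteq> {1..a}"
      "\<And>c d. c \<in> {1..k} \<Longrightarrow> d \<in> {1..k} \<Longrightarrow> \<beta> (i c) < \<beta> (i d) \<longleftrightarrow> id c < id d"
    unfolding contains_pattern_def by blast
  have \<beta>_last: "\<beta> (Suc a) = Suc a" using permutes_not_in[OF assms] by simp
  have bounds: "1 \<le> i c" "i c \<le> a" "\<beta> (i c) \<le> a" if "1 \<le> c" "c \<le> k" for c
    using i(2) that permutes_atLeastAtMost_bounds[OF assms, of "i c"] by (auto simp: image_subset_iff)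
  \<comment> \<open>Position \<open>Suc a\<close> carries the value \<open>Suc a\<close>, above
    every value of \<beta> at the old positions.\<close>
  define i' where "i' = i(Suc k := Suc a)"
  have "strict_mono_on {1..Suc k} i'"
    using i(1) bounds by (fastforce simp: i'_def strict_mono_on_def le_Suc_eq less_Suc_eq_le)
  moreover have "i' ` {1..Suc k} \<subseteq> {1..Suc a}"
    using bounds by (fastforce simp: i'_def le_Suc_eq)
  moreover have "\<beta> (i' c) < \<beta> (i' d) \<longleftrightarrow> id c < id d" if "c \<in> {1..Suc k}" "d \<in> {1..Suc k}" for c d
    using that i(3)[of c d] bounds[of c] bounds[of d] by (auto simp: i'_def \<beta>_last le_Suc_eq)
  ultimately show "contains_pattern (Suc a) \<beta> (Suc k) id"
    unfolding contains_pattern_def by blast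
qed

section \<open>Pattern containment under inversion\<close>

lemma contains_inv:
  assumes \<alpha>: "\<alpha> permutes {1..n}" and \<tau>: "\<tau> permutes {1..k}" and "contains_pattern n \<alpha> k \<tau>"
  shows "contains_pattern n (inv \<alpha>) k (inv \<tau>)"
proof -
  obtain i where i: "strict_mono_on {1..k} i" "i ` {1..k} \<subseteq> {1..n}"
      "\<And>c d. c \<in> {1..k} \<Longrightarrow> d \<in> {1..k} \<Longrightarrow> \<alpha> (i c) < \<alpha> (i d) \<longleftrightarrow> \<tau> c < \<tau> d"
    using assms(3) unfolding contains_pattern_def by blast
  have \<tau>_in: "inv \<tau> c \<in> {1..k}" if "c \<in> {1..k}" for c
    using permutes_in_image[OF permutes_inv[OF \<tau>]] that by blast
  \<comment> \<open>Positions of \<open>inv \<alpha>\<close> are values of \<alpha>. The value of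
    pattern rank \<open>c\<close> occurs at position \<open>i (inv \<tau> c)\<close>, so this lists
    the values of the occurrence in increasing order.\<close>
  let ?i = "\<lambda>c. \<alpha> (i (inv \<tau> c))"
  have "strict_mono_on {1..k} ?i"
    using i(3)[OF \<tau>_in \<tau>_in] by (simp add: strict_mono_on_def permutes_inverses[OF \<tau>])
  moreover have "?i ` {1..k} \<subseteq> {1..n}"
  proof
    fix y assume "y \<in> ?i ` {1..k}"
    then obtain c where "c \<in> {1..k}" "y = ?i c" by blast
    moreover have "i (inv \<tau> c) \<in> {1..n}" using i(2) \<tau>_in[OF \<open>c \<in> {1..k}\<close>] by blast
    ultimately show "y \<in> {1..n}" using permutes_in_image[OF \<alpha>] by blast
  qed
  moreover have "inv \<alpha> (?i c) < inv \<alpha> (?i d) \<longleftrightarrow> inv \<tau> c < inv \<tau> d"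
    if "c \<in> {1..k}" "d \<in> {1..k}" for c d
    using strict_mono_on_less[OF i(1) \<tau>_in[OF that(1)] \<tau>_in[OF that(2)]]
    by (simp add: permutes_inverses[OF \<alpha>])
  ultimately show ?thesis
    unfolding contains_pattern_def by blast
qed

lemma contains_inv_id_iff:
  assumes "\<alpha> permutes {1..n}"
  shows "contains_pattern n (inv \<alpha>) k id \<longleftrightarrow> contains_pattern n \<alpha> k id"
  using contains_inv[OF assms permutes_id, of k]
    contains_inv[OF permutes_inv[OF assms] permutes_id, of k]
  by (auto simp: permutes_inv_inv[OF assms])

lemma contains_inv_132_iff:
  assumes "\<alpha> permutes {1..n}"
  shows "contains_pattern n (inv \<alpha>) 3 pattern_132 \<longleftrightarrow> contains_pattern n \<alpha> 3 pattern_132"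
proof -
  have \<tau>: "pattern_132 permutes {1..3}"
    unfolding pattern_132_def by (rule permutes_swap_id) auto
  have "inv pattern_132 = pattern_132" by (simp add: pattern_132_def)
  then show ?thesis
    using contains_inv[OF assms \<tau>] contains_inv[OF permutes_inv[OF assms] \<tau>]
    by (auto simp: permutes_inv_inv[OF assms])
qed

section \<open>Values before and after the maximum\<close>

lemma downward_closed_eq_atLeastAtMost:
  fixes S :: "nat set"
  assumes "finite S" "0 \<notin> S" and down: "\<And>x y. x \<in> S \<Longrightarrow> 1 \<le> y \<Longrightarrow> y \<le> x \<Longrightarrow> y \<in> S"
  shows "S = {1..card S}"
proof (cases "S = {}")
  case False
  then have "S = {1..Max S}"
    using assms Max_in[of S] Max_ge[of S] by (fastforce simp: Suc_le_eq intro!: gr0I)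
  then show ?thesis by (metis card_atLeastAtMost diff_Suc_1)
qed simp

text \<open>A smaller entry before the maximum and a larger one after it would form 132 with the
  maximum. So the values after it are closed downwards, and their number \<open>n - a\<close>
  determines them.\<close>

lemma avoids_132_image_prefix:
  assumes \<alpha>: "\<alpha> permutes {1..Suc n}" and avoids: "avoids_pattern (Suc n) \<alpha> 3 pattern_132"
    and a: "a \<le> n" and max: "\<alpha> (Suc a) = Suc n"
  shows "\<alpha> ` {1..Suc a} = {n - a + 1..Suc n}"
proof -
  define S where "S = \<alpha> ` {a + 2..Suc n}"
  have inj: "\<alpha> i = \<alpha> j \<longleftrightarrow> i = j" for i j using permutes_inj[OF \<alpha>] by (meson injD)
  have less: "\<alpha> j < \<alpha> i" if "i \<in> {1..Suc a}" "j \<in> {a + 2..Suc n}" for i j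
  proof (cases "i = Suc a")
    case True
    then show ?thesis
      using max inj[of i j] that permutes_atLeastAtMost_bounds[OF \<alpha>, of j] by auto
  next
    case False
    show ?thesis
    proof (rule ccontr)
      assume "\<not> \<alpha> j < \<alpha> i"
      then have "\<alpha> i < \<alpha> j" using inj[of i j] that by fastforce
      moreover have "\<alpha> j < \<alpha> (Suc a)"
        using max inj[of "Suc a" j] that permutes_atLeastAtMost_bounds[OF \<alpha>, of j] by auto
      moreover have "1 \<le> i" "i < Suc a" "Suc a < j" "j \<le> Suc n" using that False by auto
      ultimately show False using avoids unfolding contains_132_iff by blast
    qed
  qed
  have full: "\<alpha> ` {1..Suc a} \<union> S = {1..Suc n}"
  proof -
    have "\<alpha> ` {1..Suc a} \<union> S = \<alpha> ` ({1..Suc a} \<union> {a + 2..Suc n})"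
      unfolding S_def by blast
    also have "{1..Suc a} \<union> {a + 2..Suc n} = {1..Suc n}" using a by auto
    finally show ?thesis using permutes_image[OF \<alpha>] by simp
  qed
  have "S = {1..card S}"
  proof (rule downward_closed_eq_atLeastAtMost)
    show "finite S" by (simp add: S_def)
    show "0 \<notin> S" using full by (metis Un_iff atLeastAtMost_iff not_one_le_zero)
    fix x y assume xy: "x \<in> S" "1 \<le> y" "y \<le> x"
    then obtain j where j: "j \<in> {a + 2..Suc n}" "x = \<alpha> j" by (auto simp: S_def)
    have "x \<in> {1..Suc n}" using xy(1) full by blast
    then have "y \<in> {1..Suc n}" using xy by simp
    moreover have "y \<notin> \<alpha> ` {1..Suc a}" using less j xy by fastforce
    ultimately show "y \<in> S" using full by blast
  qed
  moreover have "card S = n - a"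
    unfolding S_def using card_image[OF inj_on_subset[OF permutes_inj[OF \<alpha>] subset_UNIV]] by simp
  ultimately have S: "S = {1..n - a}" by simp
  have "\<alpha> ` {1..Suc a} \<inter> S = {}" unfolding S_def using less by fastforce
  then have "\<alpha> ` {1..Suc a} = {1..Suc n} - {1..n - a}" using full S by blast
  also have "\<dots> = {n - a + 1..Suc n}" by auto
  finally show ?thesis .
qed

section \<open>Decomposition of 132-avoiding permutations\<close>

definition avoiders :: "nat \<Rightarrow> nat \<Rightarrow> (nat \<Rightarrow> nat) set" where
  "avoiders k n = {\<alpha>. \<alpha> permutes {1..n} \<and>
     avoids_pattern n \<alpha> 3 pattern_132 \<and> avoids_pattern n \<alpha> k id}"

definition involutive_avoiders :: "nat \<Rightarrow> nat \<Rightarrow> (nat \<Rightarrow> nat) set" where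
  "involutive_avoiders k n = {\<alpha> \<in> avoiders k n. inv \<alpha> = \<alpha>}"

lemma num_involutions_eq_card: "num_involutions k n = card (involutive_avoiders k n)"
  unfolding num_involutions_def involutive_avoiders_def avoiders_def
  by (rule arg_cong[where f = card]) auto

lemma avoiders_permutes: "\<alpha> \<in> avoiders k n \<Longrightarrow> \<alpha> permutes {1..n}"
  by (simp add: avoiders_def)

lemma finite_avoiders: "finite (avoiders k n)"
  by (rule finite_subset[OF _ finite_permutations[of "{1..n}"]]) (auto simp: avoiders_def)

lemma finite_involutive_avoiders: "finite (involutive_avoiders k n)"
  by (simp add: involutive_avoiders_def finite_avoiders)

text \<open>Every permutation contains the empty pattern, so the recursion on \<open>k\<close>
  starts from the zero series.\<close>

lemma avoiders_0 [simp]: "avoiders 0 n = {}"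
  by (simp add: avoiders_def contains_pattern_def strict_mono_on_def)

lemma avoiders_Suc_0: "avoiders (Suc k) 0 = {id}"
proof -
  \<comment> \<open>A nonempty pattern needs a position, and \<open>{1..0}\<close> has none; 132 is
    the instance of length \<open>Suc 2\<close>.\<close>
  have "avoids_pattern 0 \<alpha> (Suc m) \<tau>" for \<alpha> m \<tau>
    unfolding contains_pattern_def by auto
  from this[of _ 2] this[of _ k] show ?thesis
    by (auto simp: avoiders_def numeral_3_eq_3)
qed

lemma inv_in_avoiders:
  assumes "\<alpha> \<in> avoiders k n"
  shows "inv \<alpha> \<in> avoiders k n"
proof -
  have "\<alpha> permutes {1..n}" using assms by (simp add: avoiders_def)
  then show ?thesis
    using assms contains_inv_id_iff contains_inv_132_iff permutes_inv[of \<alpha> "{1..n}"]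
    by (simp add: avoiders_def)
qed

lemma skew_sum_in_avoiders_iff:
  assumes "\<beta> permutes {1..a}" "\<gamma> permutes {1..b}"
  shows "skew_sum a b \<beta> \<gamma> \<in> avoiders (Suc k) (a + b) \<longleftrightarrow>
    \<beta> \<in> avoiders (Suc k) a \<and> \<gamma> \<in> avoiders (Suc k) b"
proof -
  have "pattern_132 1 < pattern_132 c" if "c \<in> {2..3}" for c
    using that by (auto simp: pattern_132_def transpose_def)
  then show ?thesis
    using contains_skew_sum_iff[OF assms, of 3 pattern_132]
      contains_skew_sum_iff[OF assms, of "Suc k" id] skew_sum_permutes[OF assms] assms
    by (auto simp: avoiders_def)
qed

text \<open>
  A permutation \<open>\<beta>\<close> of \<open>{1..a}\<close> fixes \<open>a + 1\<close>, so the same function read on \<open>{1..Suc a}\<close> is \<open>\<beta> \<oplus> 1\<close>.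
\<close>

lemma permutes_in_avoiders_Suc_iff:
  assumes "\<beta> permutes {1..a}"
  shows "\<beta> \<in> avoiders (Suc k) (Suc a) \<longleftrightarrow> \<beta> \<in> avoiders k a"
  using contains_id_Suc_iff[OF assms, of k] contains_132_Suc_iff[OF assms] assms
    permutes_subset[OF assms, of "{1..Suc a}"]
  by (auto simp: avoiders_def)

lemma permutes_atLeastAtMost_Suc:
  assumes "\<beta> permutes {1..a}"
  shows "\<beta> permutes {1..Suc a}"
  using assms by (rule permutes_subset) auto

text \<open>The cut is made just behind the maximum; \<open>a\<close> counts the entries before
  it.\<close>

lemma avoiders_decomposition:
  assumes "\<alpha> \<in> avoiders (Suc k) (Suc n)"
  obtains a \<beta> \<gamma> where "a \<le> n" "\<beta> \<in> avoiders k a" "\<gamma> \<in> avoiders (Suc k) (n - a)"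
    "\<alpha> = skew_sum (Suc a) (n - a) \<beta> \<gamma>"
proof -
  have \<alpha>: "\<alpha> permutes {1..Suc n}" and avoids: "avoids_pattern (Suc n) \<alpha> 3 pattern_132"
    using assms by (auto simp: avoiders_def)
  have "Suc n \<in> \<alpha> ` {1..Suc n}" using permutes_image[OF \<alpha>] by simp
  then obtain m where "m \<in> {1..Suc n}" "\<alpha> m = Suc n" by force
  then obtain a where a: "a \<le> n" "\<alpha> (Suc a) = Suc n" by (cases m) auto
  have size: "Suc a + (n - a) = Suc n" using a by simp
  have "\<alpha> permutes {1..Suc a + (n - a)}" using \<alpha> size by simp
  moreover have "\<alpha> ` {1..Suc a} = {n - a + 1..Suc a + (n - a)}"
    using avoids_132_image_prefix[OF \<alpha> avoids a] size by simp
  ultimately obtain \<beta> \<gamma> where \<beta>: "\<beta> permutes {1..Suc a}" and \<gamma>: "\<gamma> permutes {1..n - a}"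
    and eq: "\<alpha> = skew_sum (Suc a) (n - a) \<beta> \<gamma>"
    by (rule skew_sum_decomposition)
  \<comment> \<open>After the shift by \<open>n - a\<close> the maximum becomes a fixed point at the
    end of the first block, so this block is a permutation of \<open>{1..a}\<close> followed by its
    maximum.\<close>
  have "\<beta> (Suc a) + (n - a) = Suc n" using a(2) by (simp add: eq skew_sum_def)
  then have "\<beta> (Suc a) = Suc a" using size by simp
  then have "\<beta> permutes {1..a}"
    using \<beta> by (intro permutes_superset[OF \<beta>]) (auto simp: le_Suc_eq)
  then show ?thesis
    using that[OF a(1) _ _ eq] assms skew_sum_in_avoiders_iff[OF \<beta> \<gamma>, of k] size
      permutes_in_avoiders_Suc_iff[of \<beta> a k] by (simp add: eq)
qed

text \<open>Converse of the decomposition. The second claim locates the maximum, from which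
  \<open>a\<close> can be recovered.\<close>

lemma skew_sum_avoiders:
  assumes "a \<le> n" "\<beta> \<in> avoiders k a" "\<gamma> \<in> avoiders (Suc k) (n - a)"
  shows "skew_sum (Suc a) (n - a) \<beta> \<gamma> \<in> avoiders (Suc k) (Suc n)"
    and "skew_sum (Suc a) (n - a) \<beta> \<gamma> (Suc a) = Suc n"
proof -
  note \<beta> = avoiders_permutes[OF assms(2)] and \<gamma> = avoiders_permutes[OF assms(3)]
  show "skew_sum (Suc a) (n - a) \<beta> \<gamma> \<in> avoiders (Suc k) (Suc n)"
    using skew_sum_in_avoiders_iff[OF permutes_atLeastAtMost_Suc[OF \<beta>] \<gamma>, of k]
      permutes_in_avoiders_Suc_iff[OF \<beta>] assms by simp
  show "skew_sum (Suc a) (n - a) \<beta> \<gamma> (Suc a) = Suc n"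
    using permutes_not_in[OF \<beta>, of "Suc a"] assms(1) by (simp add: skew_sum_def)
qed

text \<open>The position of the maximum separates the images for different \<open>a\<close>; for
  fixed \<open>a\<close>, \<open>skew_sum_eq_iff\<close> recovers both summands.\<close>

lemma card_avoiders_Suc:
  "card (avoiders (Suc k) (Suc n)) =
    (\<Sum>a\<le>n. card (avoiders k a) * card (avoiders (Suc k) (n - a)))"
proof -
  let ?f = "\<lambda>a. \<lambda>(\<beta>, \<gamma>). skew_sum (Suc a) (n - a) \<beta> \<gamma>"
  let ?P = "\<lambda>a. avoiders k a \<times> avoiders (Suc k) (n - a)"
  have "avoiders (Suc k) (Suc n) = (\<Union>a\<le>n. ?f a ` ?P a)"
  proof
    show "avoiders (Suc k) (Suc n) \<subseteq> (\<Union>a\<le>n. ?f a ` ?P a)"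
      by (auto elim!: avoiders_decomposition)
    show "(\<Union>a\<le>n. ?f a ` ?P a) \<subseteq> avoiders (Suc k) (Suc n)"
      using skew_sum_avoiders(1) by auto
  qed
  then have "card (avoiders (Suc k) (Suc n)) = card (\<Union>a\<le>n. ?f a ` ?P a)"
    by (rule arg_cong)
  also have "\<dots> = (\<Sum>a\<le>n. card (?f a ` ?P a))"
  proof (rule card_UN_disjoint)
    show "\<forall>a\<in>{..n}. \<forall>b\<in>{..n}. a \<noteq> b \<longrightarrow> ?f a ` ?P a \<inter> ?f b ` ?P b = {}"
    proof (intro ballI impI)
      fix a b assume ab: "a \<in> {..n}" "b \<in> {..n}" "a \<noteq> b"
      have False if "\<alpha> \<in> ?f a ` ?P a" "\<alpha> \<in> ?f b ` ?P b" for \<alpha>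
      proof -
        have "\<alpha> (Suc a) = Suc n" "\<alpha> (Suc b) = Suc n"
          using that ab by (auto intro: skew_sum_avoiders(2))
        moreover have "\<alpha> permutes {1..Suc n}"
          using that(1) ab skew_sum_avoiders(1) avoiders_permutes by fastforce
        ultimately show False using ab(3) permutes_inj by (metis injD nat.inject)
      qed
      then show "?f a ` ?P a \<inter> ?f b ` ?P b = {}" by blast
    qed
  qed (simp_all add: finite_avoiders)
  also have "\<dots> = (\<Sum>a\<le>n. card (avoiders k a) * card (avoiders (Suc k) (n - a)))"
  proof (rule sum.cong)
    fix a
    have "inj_on (?f a) (?P a)"
    proof (rule inj_onI, clarify)
      fix \<beta> \<gamma> \<beta>' \<gamma>'
      assume mem: "\<beta> \<in> avoiders k a" "\<gamma> \<in> avoiders (Suc k) (n - a)"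
          "\<beta>' \<in> avoiders k a" "\<gamma>' \<in> avoiders (Suc k) (n - a)"
        and eq: "skew_sum (Suc a) (n - a) \<beta> \<gamma> = skew_sum (Suc a) (n - a) \<beta>' \<gamma>'"
      note perms = mem[THEN avoiders_permutes]
      note perms' = permutes_atLeastAtMost_Suc[OF perms(1)] permutes_atLeastAtMost_Suc[OF perms(3)]
      from skew_sum_eq_iff[OF perms'(1) perms(2) perms'(2) perms(4)] eq show "\<beta> = \<beta>' \<and> \<gamma> = \<gamma>'" by simp
    qed
    then show "card (?f a ` ?P a) = card (avoiders k a) * card (avoiders (Suc k) (n - a))"
      by (simp add: card_image card_cartesian_product)
  qed simp
  finally show ?thesis .
qed

section \<open>Decomposition of 132-avoiding involutions\<close>

text \<open>Inversion reverses three blocks and inverts each of them, so the outer blocks of an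
  involution must be inverse to each other. The middle block has length \<open>m\<close>.\<close>

definition palindromic_skew_sum :: "nat \<Rightarrow> nat \<Rightarrow> (nat \<Rightarrow> nat) \<Rightarrow> (nat \<Rightarrow> nat) \<Rightarrow> nat \<Rightarrow> nat" where
  "palindromic_skew_sum a m \<beta> \<tau> =
     skew_sum a (m + a) \<beta> (skew_sum m a \<tau> (inv \<beta>))"

lemma inv_palindromic_skew_sum:
  assumes "\<beta> permutes {1..a}" "\<tau> permutes {1..m}"
  shows "inv (palindromic_skew_sum a m \<beta> \<tau>) = palindromic_skew_sum a m \<beta> (inv \<tau>)"
proof -
  have "inv (palindromic_skew_sum a m \<beta> \<tau>) =
      skew_sum (m + a) a (skew_sum a m (inv (inv \<beta>)) (inv \<tau>)) (inv \<beta>)"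
    unfolding palindromic_skew_sum_def
    using inv_skew_sum[OF assms(1) skew_sum_permutes[OF assms(2) permutes_inv[OF assms(1)]]]
      inv_skew_sum[OF assms(2) permutes_inv[OF assms(1)]] by simp
  also have "\<dots> = skew_sum (a + m) a (skew_sum a m \<beta> (inv \<tau>)) (inv \<beta>)"
    by (simp add: permutes_inv_inv[OF assms(1)] add.commute)
  finally show ?thesis by (simp add: skew_sum_assoc palindromic_skew_sum_def)
qed

text \<open>The second block is shown to split after \<open>m = b - a\<close> entries; comparing the
  three blocks of the involution with those of its inverse then identifies them.\<close>

lemma involution_skew_sumE:
  assumes inv: "inv (skew_sum a b \<beta> \<gamma>) = skew_sum a b \<beta> \<gamma>" and "a \<le> b"
    and \<beta>: "\<beta> permutes {1..a}" and \<gamma>: "\<gamma> permutes {1..b}"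
  obtains \<tau> where "\<tau> permutes {1..b - a}" "inv \<tau> = \<tau>" "\<gamma> = skew_sum (b - a) a \<tau> (inv \<beta>)"
proof -
  define m where "m = b - a"
  have b: "b = m + a" using \<open>a \<le> b\<close> by (simp add: m_def)
  let ?\<alpha> = "skew_sum a b \<beta> \<gamma>"
  have invol: "?\<alpha> (?\<alpha> x) = x" for x
    using inv permutes_inverses(2)[OF skew_sum_permutes[OF \<beta> \<gamma>], of x] by simp
  \<comment> \<open>If \<open>y = \<gamma> i\<close> were at most \<open>a\<close>, then
    \<open>?\<alpha> y\<close> would exceed \<open>b\<close>, as on the whole first block; but the
    involution returns \<open>a + i\<close>, which is at most \<open>b\<close>.\<close>
  have "\<gamma> ` {1..m} \<subseteq> {a + 1..m + a}"
  proof
    fix y assume "y \<in> \<gamma> ` {1..m}"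
    then obtain i where i: "1 \<le> i" "i \<le> m" "y = \<gamma> i" by auto
    have bounds: "1 \<le> y" "y \<le> b"
      using permutes_atLeastAtMost_bounds[OF \<gamma>, of i] i b by auto
    have "?\<alpha> (a + i) = y" using i b by (simp add: skew_sum_def)
    then have "?\<alpha> y = a + i" using invol[of "a + i"] by simp
    moreover have "?\<alpha> y > b" if "y \<le> a"
      using that bounds permutes_atLeastAtMost_bounds[OF \<beta>, of y] by (simp add: skew_sum_def)
    ultimately have "\<not> y \<le> a" using i b by auto
    then show "y \<in> {a + 1..m + a}" using bounds b by simp
  qed
  moreover have "card (\<gamma> ` {1..m}) = card {a + 1..m + a}"
    using card_image[OF inj_on_subset[OF permutes_inj[OF \<gamma>] subset_UNIV]] by simp
  ultimately have "\<gamma> ` {1..m} = {a + 1..m + a}"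
    by (intro card_subset_eq) auto
  then obtain \<tau> \<delta> where \<tau>: "\<tau> permutes {1..m}" and \<delta>: "\<delta> permutes {1..a}"
    and \<gamma>_eq: "\<gamma> = skew_sum m a \<tau> \<delta>"
    using skew_sum_decomposition[of \<gamma> m a] \<gamma> b by blast
  note perms = permutes_inv[OF \<beta>] permutes_inv[OF \<tau>] permutes_inv[OF \<delta>]
  have "inv ?\<alpha> = skew_sum (m + a) a (skew_sum a m (inv \<delta>) (inv \<tau>)) (inv \<beta>)"
    using inv_skew_sum[OF \<beta> \<gamma>] inv_skew_sum[OF \<tau> \<delta>] by (simp add: \<gamma>_eq b)
  also have "\<dots> = skew_sum a (m + a) (inv \<delta>) (skew_sum m a (inv \<tau>) (inv \<beta>))"
    using skew_sum_assoc[of a m a "inv \<delta>" "inv \<tau>" "inv \<beta>"] by (simp add: add.commute)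
  finally have "skew_sum a (m + a) (inv \<delta>) (skew_sum m a (inv \<tau>) (inv \<beta>)) =
      skew_sum a (m + a) \<beta> (skew_sum m a \<tau> \<delta>)"
    using inv by (simp add: \<gamma>_eq b)
  \<comment> \<open>Uniqueness of the summands is applied twice, peeling off the outer block
    first.\<close>
  then have "skew_sum m a (inv \<tau>) (inv \<beta>) = skew_sum m a \<tau> \<delta>"
    using skew_sum_eq_iff[OF perms(3) skew_sum_permutes[OF perms(2,1)] \<beta> skew_sum_permutes[OF \<tau> \<delta>]]
    by simp
  then have "inv \<tau> = \<tau>" "inv \<beta> = \<delta>"
    using skew_sum_eq_iff[OF perms(2,1) \<tau> \<delta>] by auto
  then show ?thesis using that \<tau> \<gamma>_eq by (simp add: m_def)
qed

lemma skew_sum_0_right: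
  assumes "\<beta> permutes {1..a}"
  shows "skew_sum (Suc a) 0 \<beta> \<gamma> = \<beta>"
proof
  fix i
  show "skew_sum (Suc a) 0 \<beta> \<gamma> i = \<beta> i"
    using permutes_not_in[OF assms, of i] by (auto simp: skew_sum_def)
qed

text \<open>The second hypothesis excludes the form \<open>\<beta> \<oplus> 1\<close>, which is the
  case of the maximum in last position.\<close>

lemma involutive_avoiders_decomposition:
  assumes "\<alpha> \<in> involutive_avoiders (Suc k) (Suc n)" "\<alpha> \<notin> involutive_avoiders k n"
  obtains a \<beta> \<tau> where "2 * a + 1 \<le> n" "\<beta> \<in> avoiders k a"
    "\<tau> \<in> involutive_avoiders (Suc k) (n - (2 * a + 1))"
    "\<alpha> = palindromic_skew_sum (Suc a) (n - (2 * a + 1)) \<beta> \<tau>"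
proof -
  have \<alpha>: "\<alpha> \<in> avoiders (Suc k) (Suc n)" and inv: "inv \<alpha> = \<alpha>"
    using assms(1) by (auto simp: involutive_avoiders_def)
  obtain a \<beta> \<gamma> where a: "a \<le> n" and \<beta>: "\<beta> \<in> avoiders k a" and \<gamma>: "\<gamma> \<in> avoiders (Suc k) (n - a)"
    and eq: "\<alpha> = skew_sum (Suc a) (n - a) \<beta> \<gamma>"
    using avoiders_decomposition[OF \<alpha>] by blast
  note \<beta>_perm = avoiders_permutes[OF \<beta>]
  note \<beta>_perm' = permutes_atLeastAtMost_Suc[OF \<beta>_perm]
  note \<gamma>_perm = avoiders_permutes[OF \<gamma>]
  have "a \<noteq> n"
  proof
    assume "a = n"
    then have "\<alpha> = \<beta>" using eq skew_sum_0_right[OF \<beta>_perm] by simp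
    then show False using assms(2) \<beta> inv \<open>a = n\<close> by (simp add: involutive_avoiders_def)
  qed
  then have "a < n" using a by simp
  \<comment> \<open>The involution swaps \<open>Suc a\<close> and \<open>Suc n\<close>. Hence
    \<open>Suc a\<close> is a value of the second block and at most \<open>n - a\<close>, so the
    first block is not longer than the second.\<close>
  have "\<alpha> (Suc a) = Suc n" using skew_sum_avoiders(2)[OF a \<beta> \<gamma>] eq by simp
  then have "\<alpha> (Suc n) = Suc a"
    using inv permutes_inverses(2)[OF avoiders_permutes[OF \<alpha>], of "Suc a"] by simp
  moreover have "\<alpha> (Suc n) = \<gamma> (n - a)" using \<open>a < n\<close> by (simp add: eq skew_sum_def)
  moreover have "\<gamma> (n - a) \<le> n - a"
    using \<open>a < n\<close> by (intro permutes_atLeastAtMost_bounds(2)[OF \<gamma>_perm]) auto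
  ultimately have le: "Suc a \<le> n - a" by simp
  \<comment> \<open>The two outer blocks have length \<open>Suc a\<close> each, leaving
    \<open>Suc n - 2 * Suc a\<close> entries.\<close>
  define m where "m = n - (2 * a + 1)"
  have m: "n - a - Suc a = m" "n - a = m + Suc a" using le by (auto simp: m_def)
  obtain \<tau> where \<tau>: "\<tau> permutes {1..m}" "inv \<tau> = \<tau>" "\<gamma> = skew_sum m (Suc a) \<tau> (inv \<beta>)"
    using involution_skew_sumE[OF inv[unfolded eq] le \<beta>_perm' \<gamma>_perm] m(1) by metis
  have "\<tau> \<in> avoiders (Suc k) m"
    using \<gamma> skew_sum_in_avoiders_iff[OF \<tau>(1) permutes_inv[OF \<beta>_perm'], of k]
    by (simp add: \<tau>(3) m(2))
  then have "\<tau> \<in> involutive_avoiders (Suc k) m" using \<tau>(2) by (simp add: involutive_avoiders_def)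
  moreover have "\<alpha> = palindromic_skew_sum (Suc a) m \<beta> \<tau>"
    using eq by (simp add: palindromic_skew_sum_def \<tau>(3) m(2))
  moreover have "2 * a + 1 \<le> n" using le by simp
  ultimately show ?thesis using that \<beta> m_def by blast
qed

text \<open>The converse; again the place of the maximum is recorded in order to recover
  \<open>a\<close>.\<close>

lemma palindromic_skew_sum_involutive_avoiders:
  assumes "2 * a + 1 \<le> n" "\<beta> \<in> avoiders k a" "\<tau> \<in> involutive_avoiders (Suc k) (n - (2 * a + 1))"
  shows "palindromic_skew_sum (Suc a) (n - (2 * a + 1)) \<beta> \<tau> \<in> involutive_avoiders (Suc k) (Suc n)"
    and "palindromic_skew_sum (Suc a) (n - (2 * a + 1)) \<beta> \<tau> (Suc a) = Suc n"
proof -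
  define m where "m = n - (2 * a + 1)"
  have n: "n - a = m + Suc a" and a: "a \<le> n" using assms(1) by (auto simp: m_def)
  have \<tau>: "\<tau> \<in> avoiders (Suc k) m" "inv \<tau> = \<tau>"
    using assms(3) by (auto simp: involutive_avoiders_def m_def)
  note \<beta>_perm = avoiders_permutes[OF assms(2)]
  note \<beta>_perm' = permutes_atLeastAtMost_Suc[OF \<beta>_perm]
  have "inv \<beta> \<in> avoiders (Suc k) (Suc a)"
    using inv_in_avoiders[OF assms(2)] permutes_in_avoiders_Suc_iff[OF permutes_inv[OF \<beta>_perm]]
    by simp
  then have \<gamma>: "skew_sum m (Suc a) \<tau> (inv \<beta>) \<in> avoiders (Suc k) (n - a)"
    using skew_sum_in_avoiders_iff[OF avoiders_permutes[OF \<tau>(1)] permutes_inv[OF \<beta>_perm'], of k] \<tau>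
    by (simp add: n)
  have eq: "palindromic_skew_sum (Suc a) m \<beta> \<tau> =
      skew_sum (Suc a) (n - a) \<beta> (skew_sum m (Suc a) \<tau> (inv \<beta>))"
    by (simp add: palindromic_skew_sum_def n)
  have "inv (palindromic_skew_sum (Suc a) m \<beta> \<tau>) = palindromic_skew_sum (Suc a) m \<beta> \<tau>"
    using inv_palindromic_skew_sum[OF \<beta>_perm' avoiders_permutes[OF \<tau>(1)]] \<tau>(2) by simp
  then show "palindromic_skew_sum (Suc a) (n - (2 * a + 1)) \<beta> \<tau> \<in> involutive_avoiders (Suc k) (Suc n)"
    using skew_sum_avoiders(1)[OF a assms(2) \<gamma>]
    unfolding m_def[symmetric] by (simp add: involutive_avoiders_def eq)
  show "palindromic_skew_sum (Suc a) (n - (2 * a + 1)) \<beta> \<tau> (Suc a) = Suc n"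
    using skew_sum_avoiders(2)[OF a assms(2) \<gamma>] unfolding m_def[symmetric] eq .
qed

text \<open>Appending a maximum does not change the function, so the involutions
  \<open>\<beta> \<oplus> 1\<close> form a literal subset.\<close>

lemma involutive_avoiders_subset_Suc:
  "involutive_avoiders k n \<subseteq> involutive_avoiders (Suc k) (Suc n)"
  using permutes_in_avoiders_Suc_iff avoiders_permutes
  by (auto simp: involutive_avoiders_def)

lemma num_involutions_Suc:
  "num_involutions (Suc k) (Suc n) = num_involutions k n +
    (\<Sum>a | 2 * a + 1 \<le> n. card (avoiders k a) * num_involutions (Suc k) (n - (2 * a + 1)))"
proof -
  let ?f = "\<lambda>a. \<lambda>(\<beta>, \<tau>). palindromic_skew_sum (Suc a) (n - (2 * a + 1)) \<beta> \<tau>"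
  let ?P = "\<lambda>a. avoiders k a \<times> involutive_avoiders (Suc k) (n - (2 * a + 1))"
  let ?A = "{a. 2 * a + 1 \<le> n}"
  have fin: "finite ?A" by (rule finite_subset[of _ "{..n}"]) auto
  have image: "\<alpha> \<in> involutive_avoiders (Suc k) (Suc n)" "\<alpha> (Suc a) = Suc n" "\<alpha> permutes {1..Suc n}"
    if a: "a \<in> ?A" and \<alpha>: "\<alpha> \<in> ?f a ` ?P a" for a \<alpha>
  proof -
    obtain \<beta> \<tau> where "\<beta> \<in> avoiders k a" "\<tau> \<in> involutive_avoiders (Suc k) (n - (2 * a + 1))"
      "\<alpha> = palindromic_skew_sum (Suc a) (n - (2 * a + 1)) \<beta> \<tau>"
      using \<alpha> by auto
    then show "\<alpha> \<in> involutive_avoiders (Suc k) (Suc n)" "\<alpha> (Suc a) = Suc n"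
      using palindromic_skew_sum_involutive_avoiders a by blast+
    then show "\<alpha> permutes {1..Suc n}"
      using avoiders_permutes by (auto simp: involutive_avoiders_def)
  qed
  have "involutive_avoiders (Suc k) (Suc n) = involutive_avoiders k n \<union> (\<Union>a\<in>?A. ?f a ` ?P a)"
  proof
    show "involutive_avoiders (Suc k) (Suc n) \<subseteq> involutive_avoiders k n \<union> (\<Union>a\<in>?A. ?f a ` ?P a)"
    proof
      fix \<alpha> assume \<alpha>: "\<alpha> \<in> involutive_avoiders (Suc k) (Suc n)"
      show "\<alpha> \<in> involutive_avoiders k n \<union> (\<Union>a\<in>?A. ?f a ` ?P a)"
      proof (cases "\<alpha> \<in> involutive_avoiders k n")
        case False
        obtain a \<beta> \<tau> where "2 * a + 1 \<le> n" "\<beta> \<in> avoiders k a"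
          "\<tau> \<in> involutive_avoiders (Suc k) (n - (2 * a + 1))"
          "\<alpha> = palindromic_skew_sum (Suc a) (n - (2 * a + 1)) \<beta> \<tau>"
          using involutive_avoiders_decomposition[OF \<alpha> False] by blast
        then have "a \<in> ?A" "\<alpha> \<in> ?f a ` ?P a" by auto
        then show ?thesis by blast
      qed simp
    qed
    show "involutive_avoiders k n \<union> (\<Union>a\<in>?A. ?f a ` ?P a) \<subseteq> involutive_avoiders (Suc k) (Suc n)"
      using image(1) involutive_avoiders_subset_Suc by blast
  qed
  then have "num_involutions (Suc k) (Suc n) =
      card (involutive_avoiders k n \<union> (\<Union>a\<in>?A. ?f a ` ?P a))"
    by (simp only: num_involutions_eq_card)
  also have "\<dots> = card (involutive_avoiders k n) + card (\<Union>a\<in>?A. ?f a ` ?P a)"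
  proof (rule card_Un_disjoint)
    \<comment> \<open>In the first family a position up to \<open>n\<close>, such as
      \<open>Suc a\<close>, has a value at most \<open>n\<close>; in the second the maximum
      \<open>Suc n\<close> stands there.\<close>
    have False if "\<alpha> \<in> involutive_avoiders k n" "a \<in> ?A" "\<alpha> \<in> ?f a ` ?P a" for \<alpha> a
    proof -
      have "\<alpha> permutes {1..n}"
        using that(1) avoiders_permutes by (auto simp: involutive_avoiders_def)
      then have "\<alpha> (Suc a) \<le> n"
        using that(2) permutes_atLeastAtMost_bounds(2)[of \<alpha> n "Suc a"] by simp
      then show False using image(2)[OF that(2,3)] by simp
    qed
    then show "involutive_avoiders k n \<inter> (\<Union>a\<in>?A. ?f a ` ?P a) = {}" by blast
  qed (use fin in \<open>simp_all add: finite_avoiders finite_involutive_avoiders\<close>)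
  also have "card (\<Union>a\<in>?A. ?f a ` ?P a) = (\<Sum>a\<in>?A. card (?f a ` ?P a))"
  proof (rule card_UN_disjoint)
    show "\<forall>a\<in>?A. \<forall>b\<in>?A. a \<noteq> b \<longrightarrow> ?f a ` ?P a \<inter> ?f b ` ?P b = {}"
    proof (intro ballI impI)
      fix a b assume ab: "a \<in> ?A" "b \<in> ?A" "a \<noteq> b"
      have False if "\<alpha> \<in> ?f a ` ?P a" "\<alpha> \<in> ?f b ` ?P b" for \<alpha>
      proof -
        have "\<alpha> (Suc a) = \<alpha> (Suc b)"
          using image(2)[OF ab(1) that(1)] image(2)[OF ab(2) that(2)] by (rule trans[OF _ sym])
        then have "Suc a = Suc b"
          by (rule injD[OF permutes_inj[OF image(3)[OF ab(1) that(1)]]])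
        then show False using ab(3) by simp
      qed
      then show "?f a ` ?P a \<inter> ?f b ` ?P b = {}" by blast
    qed
  qed (use fin in \<open>simp_all add: finite_avoiders finite_involutive_avoiders\<close>)
  also have "\<dots> = (\<Sum>a\<in>?A. card (avoiders k a) * num_involutions (Suc k) (n - (2 * a + 1)))"
  proof (rule sum.cong)
    fix a
    have "inj_on (?f a) (?P a)"
    proof (rule inj_onI, clarify)
      fix \<beta> \<tau> \<beta>' \<tau>'
      assume mem: "\<beta> \<in> avoiders k a" "\<beta>' \<in> avoiders k a"
        "\<tau> \<in> involutive_avoiders (Suc k) (n - (2 * a + 1))"
        "\<tau>' \<in> involutive_avoiders (Suc k) (n - (2 * a + 1))"
        and eq: "palindromic_skew_sum (Suc a) (n - (2 * a + 1)) \<beta> \<tau> =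
          palindromic_skew_sum (Suc a) (n - (2 * a + 1)) \<beta>' \<tau>'"
      note perms = mem(1,2)[THEN avoiders_permutes, THEN permutes_atLeastAtMost_Suc]
      have perms': "\<tau> permutes {1..n - (2 * a + 1)}" "\<tau>' permutes {1..n - (2 * a + 1)}"
        using mem(3,4) avoiders_permutes[of _ "Suc k" "n - (2 * a + 1)"]
        by (simp_all add: involutive_avoiders_def)
      note inv_perms = permutes_inv[OF perms(1)] permutes_inv[OF perms(2)]
      have "\<beta> = \<beta>' \<and> skew_sum (n - (2 * a + 1)) (Suc a) \<tau> (inv \<beta>) =
          skew_sum (n - (2 * a + 1)) (Suc a) \<tau>' (inv \<beta>')"
        using eq unfolding palindromic_skew_sum_def
        by (rule iffD1[OF skew_sum_eq_iff[OF perms(1) skew_sum_permutes[OF perms'(1) inv_perms(1)]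
              perms(2) skew_sum_permutes[OF perms'(2) inv_perms(2)]]])
      then show "\<beta> = \<beta>' \<and> \<tau> = \<tau>'"
        using skew_sum_eq_iff[OF perms'(1) inv_perms(1) perms'(2) inv_perms(2)] by blast
    qed
    then show "card (?f a ` ?P a) = card (avoiders k a) * num_involutions (Suc k) (n - (2 * a + 1))"
      by (simp add: card_image card_cartesian_product num_involutions_eq_card)
  qed simp
  finally show ?thesis by (simp only: num_involutions_eq_card)
qed

lemma num_involutions_0 [simp]: "num_involutions 0 n = 0"
  by (simp add: num_involutions_eq_card involutive_avoiders_def)

lemma num_involutions_Suc_0: "num_involutions (Suc k) 0 = 1"
proof -
  have "involutive_avoiders (Suc k) 0 = {id}"
    by (auto simp: involutive_avoiders_def avoiders_Suc_0)
  then show ?thesis by (simp add: num_involutions_eq_card)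
qed

section \<open>Generating functions\<close>

definition avoiders_gf :: "nat \<Rightarrow> real fps" where
  "avoiders_gf k = Abs_fps (\<lambda>n. real (card (avoiders k n)))"

lemma avoiders_gf_0: "avoiders_gf 0 = 0"
  by (rule fps_ext) (simp add: avoiders_gf_def)

lemma avoiders_gf_Suc:
  "avoiders_gf (Suc k) = 1 + fps_X * (avoiders_gf k * avoiders_gf (Suc k))"
proof (rule fps_ext)
  fix n
  show "avoiders_gf (Suc k) $ n = (1 + fps_X * (avoiders_gf k * avoiders_gf (Suc k))) $ n"
    by (cases n) (simp_all add: avoiders_gf_def avoiders_Suc_0 card_avoiders_Suc
        fps_mult_nth[of "Abs_fps _" "Abs_fps _"] atLeast0AtMost)
qed

text \<open>This is \<open>x C\<^sub>k(x\<^sup>2)\<close>, which turns out to be a quotient of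
  consecutive Chebyshev values. The pair of outer blocks has \<open>2 * a + 2\<close> entries; one
  factor \<open>x\<close> is kept outside.\<close>

definition odd_avoiders_gf :: "nat \<Rightarrow> real fps" where
  "odd_avoiders_gf k = fps_X * (avoiders_gf k oo fps_X ^ 2)"

lemma odd_avoiders_gf_nth:
  "odd_avoiders_gf k $ n = (if odd n then real (card (avoiders k (n div 2))) else 0)"
proof (cases n)
  case (Suc m)
  then show ?thesis
    by (simp add: odd_avoiders_gf_def fps_nth_compose_X_power avoiders_gf_def)
qed (simp add: odd_avoiders_gf_def)

lemma odd_avoiders_gf_0: "odd_avoiders_gf 0 = 0"
  by (simp add: odd_avoiders_gf_def avoiders_gf_0)

text \<open>The recurrence of \<open>avoiders_gf\<close> at \<open>x\<^sup>2\<close>, multiplied by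
  \<open>x\<close>.\<close>

lemma odd_avoiders_gf_Suc:
  "odd_avoiders_gf (Suc k) = fps_X + fps_X * odd_avoiders_gf k * odd_avoiders_gf (Suc k)"
proof -
  let ?C = "\<lambda>k. avoiders_gf k oo fps_X ^ 2"
  have "?C (Suc k) = 1 + fps_X ^ 2 * (?C k * ?C (Suc k))"
    using arg_cong[OF avoiders_gf_Suc[of k], of "\<lambda>f. f oo fps_X ^ 2"]
    by (simp add: fps_compose_add_distrib fps_compose_mult_distrib)
  then have "fps_X * ?C (Suc k) = fps_X * (1 + fps_X ^ 2 * (?C k * ?C (Suc k)))"
    by (rule arg_cong)
  also have "\<dots> = fps_X + fps_X * (fps_X * ?C k) * (fps_X * ?C (Suc k))"
    by (simp only: power2_eq_square distrib_left mult_1_right mult_ac)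
  finally show ?thesis by (simp only: odd_avoiders_gf_def)
qed

lemma involution_gf_0: "involution_gf 0 = 0"
  by (rule fps_ext) (simp add: involution_gf_def)

lemma involution_gf_Suc:
  "involution_gf (Suc k) =
    1 + fps_X * (involution_gf k + odd_avoiders_gf k * involution_gf (Suc k))"
proof (rule fps_ext)
  fix n
  show "involution_gf (Suc k) $ n =
      (1 + fps_X * (involution_gf k + odd_avoiders_gf k * involution_gf (Suc k))) $ n"
  proof (cases n)
    case 0
    then show ?thesis by (simp add: involution_gf_def num_involutions_Suc_0)
  next
    case (Suc m)
    let ?g = "\<lambda>i. odd_avoiders_gf k $ i * real (num_involutions (Suc k) (m - i))"
    \<comment> \<open>Only odd indices contribute to the convolution, and
      \<open>i = 2 * a + 1\<close> matches them with the sum in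
      \<open>num_involutions_Suc\<close>.\<close>
    have "(\<Sum>i\<le>m. ?g i) = (\<Sum>i | odd i \<and> i \<le> m. ?g i)"
      by (rule sum.mono_neutral_right) (auto simp: odd_avoiders_gf_nth)
    also have "\<dots> = (\<Sum>a | 2 * a + 1 \<le> m. ?g (2 * a + 1))"
      by (rule sum.reindex_bij_witness[of _ "\<lambda>a. 2 * a + 1" "\<lambda>i. i div 2"]) auto
    finally have "(odd_avoiders_gf k * involution_gf (Suc k)) $ m =
        (\<Sum>a | 2 * a + 1 \<le> m. real (card (avoiders k a)) * real (num_involutions (Suc k) (m - (2 * a + 1))))"
      by (simp add: fps_mult_nth involution_gf_def atLeast0AtMost odd_avoiders_gf_nth)
    moreover have "involution_gf (Suc k) $ n = involution_gf k $ m +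
        (\<Sum>a | 2 * a + 1 \<le> m. real (card (avoiders k a)) * real (num_involutions (Suc k) (m - (2 * a + 1))))"
      using Suc by (simp add: involution_gf_def num_involutions_Suc)
    ultimately show ?thesis using Suc by simp
  qed
qed

section \<open>Chebyshev polynomials\<close>

lemma chebyshev_U_0: "chebyshev_U 0 = 1"
  unfolding chebyshev_U_def
  by (rule the1_equality[OF ex1_chebyshev_U]) simp

lemma chebyshev_U_1: "chebyshev_U (Suc 0) = [:0, 2:]"
  unfolding chebyshev_U_def
  by (rule the1_equality[OF ex1_chebyshev_U]) (simp add: sin_double)

text \<open>Adding the sine formulas for \<open>(r + 2) * \<theta>\<close> plus and minus \<theta>
  shows that the right-hand side has the property that characterises the left.\<close>

lemma chebyshev_U_Suc_Suc:
  "chebyshev_U (Suc (Suc r)) = [:0, 2:] * chebyshev_U (Suc r) - chebyshev_U r"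
  unfolding chebyshev_U_def[of "Suc (Suc r)"]
proof (rule the1_equality[OF ex1_chebyshev_U], intro allI impI)
  fix \<theta> :: real assume "sin \<theta> \<noteq> 0"
  have "real (Suc (Suc r) + 1) * \<theta> = real (Suc r + 1) * \<theta> + \<theta>"
       "real (r + 1) * \<theta> = real (Suc r + 1) * \<theta> - \<theta>"
    by (simp_all add: algebra_simps)
  then have "sin (real (Suc (Suc r) + 1) * \<theta>) =
      2 * cos \<theta> * sin (real (Suc r + 1) * \<theta>) - sin (real (r + 1) * \<theta>)"
    by (simp only: sin_add sin_diff) (simp add: algebra_simps)
  then show "poly ([:0, 2:] * chebyshev_U (Suc r) - chebyshev_U r) (cos \<theta>) =
      sin (real (Suc (Suc r) + 1) * \<theta>) / sin \<theta>"
    using \<open>sin \<theta> \<noteq> 0\<close> by (simp add: poly_chebyshev_U diff_divide_distrib)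
qed

lemma chebyshev_U_at_0: "chebyshev_U_at 0 t = 1"
  by (simp add: chebyshev_U_at_def chebyshev_U_0)

lemma chebyshev_U_at_1: "chebyshev_U_at (Suc 0) t = 2 * t"
  by (simp add: chebyshev_U_at_def chebyshev_U_1 map_poly_pCons mult.commute)

lemma chebyshev_U_at_Suc_Suc:
  "chebyshev_U_at (Suc (Suc r)) t = 2 * t * chebyshev_U_at (Suc r) t - chebyshev_U_at r t"
proof -
  \<comment> \<open>The embedding of constants acts on coefficients, so these are compared;
    multiplying by \<open>[:0, 2:]\<close> shifts and doubles them.\<close>
  have "map_poly fls_const (chebyshev_U (Suc (Suc r))) =
      pCons 0 (smult 2 (map_poly fls_const (chebyshev_U (Suc r)))) - map_poly fls_const (chebyshev_U r)"
    by (rule poly_eqI) (simp add: chebyshev_U_Suc_Suc coeff_map_poly coeff_pCons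
        fls_minus_const[symmetric] fls_const_mult_const[symmetric] split: nat.split)
  then show ?thesis by (simp add: chebyshev_U_at_def)
qed

section \<open>Chebyshev values at \<open>1/(2x)\<close> and the generating functions\<close>

abbreviation cheb_inv_2x :: "nat \<Rightarrow> real fls" where
  "cheb_inv_2x r \<equiv> chebyshev_U_at r (1 / (2 * fls_X))"

lemma fls_X_times_inverse: "fls_X * (2 * (1 / (2 * fls_X))) = (1 :: real fls)"
proof -
  have "x * (2 * (1 / (2 * x))) = 1" if "x \<noteq> 0" for x :: "real fls"
    using that by (simp add: field_simps)
  then show ?thesis by (metis fls_X_nonzero)
qed

lemma cheb_inv_2x_1: "fls_X * cheb_inv_2x (Suc 0) = 1"
  by (simp only: chebyshev_U_at_1 fls_X_times_inverse)

lemma cheb_inv_2x_Suc_Suc: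
  "fls_X * cheb_inv_2x (Suc (Suc r)) = cheb_inv_2x (Suc r) - fls_X * cheb_inv_2x r"
proof -
  have "fls_X * cheb_inv_2x (Suc (Suc r)) =
      (fls_X * (2 * (1 / (2 * fls_X)))) * cheb_inv_2x (Suc r) - fls_X * cheb_inv_2x r"
    by (simp only: chebyshev_U_at_Suc_Suc right_diff_distrib mult.assoc)
  then show ?thesis by (simp only: fls_X_times_inverse mult_1)
qed

text \<open>With \<open>E\<^sub>k\<close> for \<open>odd_avoiders_gf k\<close>, the recurrence
  \<open>E\<^sub>k\<^sub>+\<^sub>1 = x / (1 - x E\<^sub>k)\<close> is the one satisfied by the
  quotients \<open>U\<^sub>k\<^sub>-\<^sub>1 / U\<^sub>k\<close>. Nonvanishing is proved along with
  it to allow division in the end.\<close>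

lemma odd_avoiders_gf_chebyshev:
  "cheb_inv_2x (Suc k) \<noteq> 0 \<and>
    fps_to_fls (odd_avoiders_gf (Suc k)) * cheb_inv_2x (Suc k) = cheb_inv_2x k"
proof (induction k)
  case 0
  have "odd_avoiders_gf (Suc 0) = fps_X"
    by (subst odd_avoiders_gf_Suc) (simp add: odd_avoiders_gf_0)
  then show ?case using cheb_inv_2x_1 by (auto simp: chebyshev_U_at_0)
next
  case (Suc k)
  let ?E = "\<lambda>k. fps_to_fls (odd_avoiders_gf k)"
  have "?E (Suc (Suc k)) * (1 - fls_X * ?E (Suc k)) = fls_X"
    using arg_cong[OF odd_avoiders_gf_Suc[of "Suc k"], of fps_to_fls]
    by (simp add: fls_times_fps_to_fls algebra_simps)
  then have "fls_X * cheb_inv_2x (Suc k) =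
      ?E (Suc (Suc k)) * (cheb_inv_2x (Suc k) - fls_X * (?E (Suc k) * cheb_inv_2x (Suc k)))"
    by (metis (no_types, opaque_lifting) left_diff_distrib mult.assoc mult_1)
  also have "\<dots> = fls_X * (?E (Suc (Suc k)) * cheb_inv_2x (Suc (Suc k)))"
    using Suc.IH cheb_inv_2x_Suc_Suc[of k] by (simp add: mult.left_commute)
  finally have "?E (Suc (Suc k)) * cheb_inv_2x (Suc (Suc k)) = cheb_inv_2x (Suc k)" by simp
  \<comment> \<open>If the next Chebyshev value were 0, this product would make the current one
    0.\<close>
  then show ?case using Suc.IH by auto
qed

text \<open>Multiplying the recurrence for \<open>involution_gf\<close> by
  \<open>cheb_inv_2x (Suc k)\<close> makes each induction step add one term to the sum.\<close>

lemma involution_gf_chebyshev: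
  "fps_to_fls (involution_gf (Suc k)) * (fls_X * cheb_inv_2x (Suc k)) = (\<Sum>j\<le>k. cheb_inv_2x j)"
proof (induction k)
  case 0
  have "involution_gf (Suc 0) = 1"
    by (subst involution_gf_Suc) (simp add: involution_gf_0 odd_avoiders_gf_0)
  then show ?case using cheb_inv_2x_1 by (simp add: chebyshev_U_at_0)
next
  case (Suc k)
  let ?I = "\<lambda>k. fps_to_fls (involution_gf k)" and ?E = "fps_to_fls (odd_avoiders_gf (Suc k))"
  have step: "?I (Suc (Suc k)) = 1 + fls_X * (?I (Suc k) + ?E * ?I (Suc (Suc k)))"
    using arg_cong[OF involution_gf_Suc[of "Suc k"], of fps_to_fls]
    by (simp add: fls_times_fps_to_fls)
  \<comment> \<open>The Chebyshev recurrence is used with \<open>cheb_inv_2x k\<close> written as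
    \<open>?E * cheb_inv_2x (Suc k)\<close>, so that the combination occurring in
    \<open>step\<close> appears.\<close>
  have "?I (Suc (Suc k)) * (fls_X * cheb_inv_2x (Suc (Suc k))) =
      ?I (Suc (Suc k)) * (cheb_inv_2x (Suc k) - fls_X * (?E * cheb_inv_2x (Suc k)))"
    using odd_avoiders_gf_chebyshev[of k] by (simp add: cheb_inv_2x_Suc_Suc)
  also have "\<dots> = cheb_inv_2x (Suc k) *
      (?I (Suc (Suc k)) - fls_X * (?E * ?I (Suc (Suc k))))"
    by (simp add: algebra_simps)
  also have "?I (Suc (Suc k)) - fls_X * (?E * ?I (Suc (Suc k))) = 1 + fls_X * ?I (Suc k)"
    using step by (simp add: algebra_simps)
  also have "cheb_inv_2x (Suc k) * (1 + fls_X * ?I (Suc k)) =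
      cheb_inv_2x (Suc k) + ?I (Suc k) * (fls_X * cheb_inv_2x (Suc k))"
    by (simp add: algebra_simps)
  finally show ?case using Suc.IH by simp
qed

theorem theorem2p7:
  fixes k :: nat
  assumes "k \<ge> 1"
  shows "fps_to_fls (involution_gf k) =
    1 / (fls_X * chebyshev_U_at k (1 / (2 * fls_X))) *
      (\<Sum>j=0..k-1. chebyshev_U_at j (1 / (2 * fls_X)))"
proof -
  obtain l where k: "k = Suc l" using assms by (cases k) auto
  have "fls_X * cheb_inv_2x k \<noteq> 0" using odd_avoiders_gf_chebyshev[of l] k by simp
  then show ?thesis
    using involution_gf_chebyshev[of l] k by (simp add: field_simps atLeast0AtMost)
qed

end
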